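(* The Farey map $T:[0,1]\to[0,1]$, regarded as a transformation of the $\sigma$-finite measure space $([0,1],\mathcal{A},\mu)$, is exact.
   Context: The Farey map is $T(x):=x/(1-x)$ for $x\in[0,1/2]$ and $T(x):=(1-x)/x$ for $x\in(1/2,1]$. $\mathcal{A}$ is the Borel $\sigma$-algebra of $[0,1]$, and $\mu$ is the infinite $\sigma$-finite $T$-invariant measure on $[0,1]$, absolutely continuous with respect to Lebesgue measure $\lambda$, given by $d\lambda=\phi_0\,d\mu$ with $\phi_0(x):=x$ (i.e. $d\mu(x)=x^{-1}\,d\lambda(x)$). A non-singular transformation $S$ of a $\sigma$-finite measure space $([0,1],\mathcal{A},m)$ is called exact if for each element $A$ of the tail $\sigma$-algebra $\bigcap_{n\in\mathbb{N}}S^{-n}(\mathcal{A})$ one has $m(A)\cdot m(A^c)=0$ (i.e. $m(A)=0$ or $m(A^c)=0$). *)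

theory Defs
  imports "HOL-Analysis.Analysis"
begin

text \<open>Intended on \<open>[0,1]\<close>; the values elsewhere are irrelevant.\<close>

definition farey_map :: "real \<Rightarrow> real" where
  "farey_map x = (if x \<le> 1/2 then x / (1 - x) else (1 - x) / x)"

text \<open>Lebesgue measure on the Borel sets of \<open>[0,1]\<close>.\<close>

definition unit_lebesgue :: "real measure" where
  "unit_lebesgue = restrict_space lborel {0..1}"

text \<open>
  The measure with density \<open>1/x\<close>. At \<open>x = 0\<close> the density is 0 (as \<open>1/0 = 0\<close>), which is
  harmless because \<open>{0}\<close> is a Lebesgue null set.
\<close>

definition farey_measure :: "real measure" where
  "farey_measure = density unit_lebesgue (\<lambda>x. ennreal (1 / x))"

definition nonsingular_transformation :: "'a measure \<Rightarrow> ('a \<Rightarrow> 'a) \<Rightarrow> bool" where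
  "nonsingular_transformation M S \<longleftrightarrow>
     S \<in> measurable M M \<and>
     (\<forall>A\<in>sets M. emeasure M (S -` A \<inter> space M) = 0 \<longleftrightarrow> emeasure M A = 0)"

definition tail_sets :: "'a measure \<Rightarrow> ('a \<Rightarrow> 'a) \<Rightarrow> 'a set set" where
  "tail_sets M S = (\<Inter>n::nat. {(S ^^ n) -` B \<inter> space M | B. B \<in> sets M})"

definition exact_transformation :: "'a measure \<Rightarrow> ('a \<Rightarrow> 'a) \<Rightarrow> bool" where
  "exact_transformation M S \<longleftrightarrow>
     sigma_finite_measure M \<and> nonsingular_transformation M S \<and>
     (\<forall>A\<in>tail_sets M S. emeasure M A = 0 \<or> emeasure M (space M - A) = 0)"

lemma space_farey_measure: "space farey_measure = {0..1}"
  by (simp add: farey_measure_def unit_lebesgue_def space_restrict_space)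

lemma sets_farey_measure: "sets farey_measure = sets (restrict_space borel {0..1})"
  by (simp add: farey_measure_def unit_lebesgue_def sets_restrict_space)

text \<open>The relation \<open>d\<lambda> = \<phi>\<^sub>0 d\<mu>\<close> with \<open>\<phi>\<^sub>0(x) = x\<close>.\<close>

lemma unit_lebesgue_eq_density: "unit_lebesgue = density farey_measure (\<lambda>x. ennreal x)"
proof -
  have meas: "(\<lambda>x. ennreal (1 / x)) \<in> borel_measurable unit_lebesgue"
    "(\<lambda>x. ennreal x) \<in> borel_measurable unit_lebesgue"
    unfolding unit_lebesgue_def by (intro measurable_restrict_space1; simp)+
  have "AE x in unit_lebesgue. ennreal (1 / x) * ennreal x = 1"
  proof -
    have "AE x in lborel. x \<noteq> (0::real)" by (rule AE_lborel_singleton)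
    then have "AE x in unit_lebesgue. x \<noteq> 0"
      unfolding unit_lebesgue_def by (subst AE_restrict_space_iff) auto
    moreover have "AE x in unit_lebesgue. x \<in> {0..1}"
      by (rule AE_I2) (simp add: unit_lebesgue_def space_restrict_space)
    ultimately show ?thesis
      by eventually_elim (simp add: ennreal_mult[symmetric])
  qed
  then have "density unit_lebesgue (\<lambda>x. ennreal (1 / x) * ennreal x)
      = density unit_lebesgue (\<lambda>_. 1)"
    using meas by (intro density_cong) auto
  then show ?thesis
    using meas by (simp add: farey_measure_def density_density_eq density_1)
qed

end

theory Submission
  imports Defs
begin

text \<open>
  Since \<open>\<mu>\<close> and Lebesgue measure \<open>\<lambda>\<close> on \<open>[0,1]\<close> have the same null sets, exactness may be tested
  with \<open>\<lambda>\<close>. Let \<open>A\<close> be a tail set, \<open>A = T\<^sup>-\<^sup>n(B n)\<close> for all \<open>n\<close>, with \<open>\<lambda>(A) > 0\<close>.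

  The inverse branches of \<open>T\<^sup>n\<close> are Moebius maps \<open>y \<mapsto> (a y + b) / (c y + d)\<close> of determinant \<open>\<plusminus>1\<close>.
  Near the indifferent fixed point \<open>0\<close> their distortion is unbounded, but it is bounded for those with
  \<open>c \<le> d\<close>, which occur whenever the orbit has just visited \<open>(1/2, 1]\<close>. Every irrational orbit does
  so infinitely often, so the images of these branches form a Vitali class. Hence one of them is
  filled by \<open>A\<close> up to a small proportion, and blowing it up by \<open>T\<^sup>n\<close> shows that \<open>B n\<close> is nearly all of
  \<open>[0,1]\<close>; then \<open>B (n + 1)\<close> is nearly full too (\<open>farey_tower_fills\<close>).

  For invariant sets, where \<open>B n = A\<close>, this is ergodicity. For tail sets \<open>B n\<close> could
  a priori be nearly full for some \<open>n\<close> and nearly empty for others. This is excluded by applying the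
  statement to the tail set \<open>D = A - B 1\<close>, whose levels are \<open>B n - B (n + 1)\<close>: consecutive levels
  are disjoint, so they cannot both be nearly full, and \<open>D\<close> must be null
  (\<open>farey_tower_disjoint_null\<close>). Exchanging the roles of the two sets gives \<open>A = B 1\<close> up to a null
  set. By shifting, all \<open>B n\<close> have the measure of \<open>A\<close>. As some of them have measure arbitrarily close
  to one, \<open>A\<close> has full measure.
\<close>

section \<open>Relative density in a Vitali class\<close>

text \<open>
  A substitute for Lebesgue's density theorem along an arbitrary Vitali class of balls. If every ball
  of the class had at least the proportion \<open>e\<close> of its measure outside \<open>S\<close>, take an open \<open>U \<supseteq> S\<close> with
  \<open>|U - S| < e |S|\<close> and a disjoint family of balls inside \<open>U\<close> that covers almost all of \<open>S\<close>. Its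
  balls have total measure at least \<open>|S|\<close>, so the parts outside \<open>S\<close> add up to at least \<open>e |S|\<close>; but
  they all lie in \<open>U - S\<close>.
\<close>

lemma ex_relatively_dense_cball:
  fixes a :: "'i \<Rightarrow> 'a::euclidean_space"
  assumes S: "S \<in> lmeasurable" "0 < measure lebesgue S" and "0 < e"
    and r: "\<And>i. i \<in> K \<Longrightarrow> 0 < r i"
    and fine: "\<And>x d. x \<in> S \<Longrightarrow> 0 < d \<Longrightarrow> \<exists>i\<in>K. x \<in> cball (a i) (r i) \<and> r i < d"
  obtains (found) i where "i \<in> K"
    "measure lebesgue (cball (a i) (r i) - S) < e * measure lebesgue (cball (a i) (r i))"
proof (rule ccontr)
  let ?B = "\<lambda>i. cball (a i) (r i)"
  assume "\<not> thesis"
  then have big: "e * measure lebesgue (?B i) \<le> measure lebesgue (?B i - S)" if "i \<in> K" for i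
    using that found not_le by blast
  obtain U where U: "open U" "S \<subseteq> U" "U - S \<in> lmeasurable"
    "emeasure lebesgue (U - S) < ennreal (e * measure lebesgue S)"
    using sets_lebesgue_outer_open[of S "e * measure lebesgue S"] S \<open>0 < e\<close> by auto
  have fine': "\<exists>i. i \<in> {i\<in>K. ?B i \<subseteq> U} \<and> x \<in> ?B i \<and> r i < d" if "x \<in> S" "0 < d" for x d
  proof -
    obtain t where t: "0 < t" "ball x t \<subseteq> U"
      using U \<open>x \<in> S\<close> openE by blast
    obtain i where i: "i \<in> K" "x \<in> ?B i" "r i < min d (t / 2)"
      using fine[OF \<open>x \<in> S\<close>, of "min d (t / 2)"] t \<open>0 < d\<close> by auto
    have "?B i \<subseteq> ball x t"
    proof
      fix y assume "y \<in> ?B i"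
      then show "y \<in> ball x t"
        using i dist_triangle[of x y "a i"] by (auto simp: dist_commute)
    qed
    then show ?thesis
      using i t by auto
  qed
  obtain C where C: "countable C" "C \<subseteq> {i\<in>K. ?B i \<subseteq> U}"
    "pairwise (\<lambda>i j. disjnt (?B i) (?B j)) C" "negligible (S - (\<Union>i\<in>C. ?B i))"
    by (rule Vitali_covering_theorem_cballs[where K = "{i\<in>K. ?B i \<subseteq> U}", OF _ fine'])
      (use r in auto)
  have dis: "disjoint_family_on ?B C"
    using C(3) by (auto simp: disjoint_family_on_def pairwise_def disjnt_def)
  then have dis': "disjoint_family_on (\<lambda>i. ?B i - S) C"
    by (auto simp: disjoint_family_on_def)
  have Bm: "?B i \<in> sets lebesgue" "?B i - S \<in> sets lebesgue" for i
    using S by (auto simp: fmeasurableD)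
  have Un: "(\<Union>i\<in>C. ?B i) \<in> sets lebesgue"
    using C(1) Bm by (intro sets.countable_UN'') auto
  have "emeasure lebesgue S \<le> emeasure lebesgue ((\<Union>i\<in>C. ?B i) \<union> (S - (\<Union>i\<in>C. ?B i)))"
    using S Un by (intro emeasure_mono) (auto simp: fmeasurableD)
  also have "\<dots> = emeasure lebesgue (\<Union>i\<in>C. ?B i)"
    using C(4) Un by (intro emeasure_Un_null_set) (auto simp: negligible_iff_null_sets)
  also have "\<dots> = (\<integral>\<^sup>+i. emeasure lebesgue (?B i) \<partial>count_space C)"
    using C(1) Bm dis by (intro emeasure_UN_countable) auto
  finally have le: "emeasure lebesgue S \<le> (\<integral>\<^sup>+i. emeasure lebesgue (?B i) \<partial>count_space C)" .
  have "ennreal (e * measure lebesgue S) = ennreal e * emeasure lebesgue S"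
    using S \<open>0 < e\<close> by (simp add: emeasure_eq_measure2 ennreal_mult fmeasurableD)
  also have "\<dots> \<le> ennreal e * (\<integral>\<^sup>+i. emeasure lebesgue (?B i) \<partial>count_space C)"
    using le by (intro mult_left_mono) auto
  also have "\<dots> = (\<integral>\<^sup>+i. ennreal e * emeasure lebesgue (?B i) \<partial>count_space C)"
    by (simp add: nn_integral_cmult)
  also have "\<dots> \<le> (\<integral>\<^sup>+i. emeasure lebesgue (?B i - S) \<partial>count_space C)"
  proof (intro nn_integral_mono)
    fix i assume "i \<in> space (count_space C)"
    then have "i \<in> K" using C(2) by auto
    have "?B i - S \<in> lmeasurable"
      using S by (intro fmeasurable.Diff) auto
    then show "ennreal e * emeasure lebesgue (?B i) \<le> emeasure lebesgue (?B i - S)"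
      using big[OF \<open>i \<in> K\<close>] \<open>0 < e\<close>
      by (simp add: emeasure_eq_measure2 ennreal_mult[symmetric])
  qed
  also have "\<dots> = emeasure lebesgue (\<Union>i\<in>C. ?B i - S)"
    using C(1) Bm dis' by (intro emeasure_UN_countable[symmetric]) auto
  also have "\<dots> \<le> emeasure lebesgue (U - S)"
    using C(2) U by (intro emeasure_mono) (auto simp: fmeasurableD)
  finally show False
    using U(4) by simp
qed

text \<open>
  The change of variables formula in the form in which distortion enters: a map whose derivative is
  at least \<open>1 / L\<close> in absolute value shrinks measure by at most the factor \<open>L\<close>.
\<close>

lemma measure_le_expanding_image:
  fixes g g' :: "real \<Rightarrow> real"
  assumes E: "E \<in> lmeasurable" and X: "X \<in> lmeasurable" "g ` E \<subseteq> X"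
    and der: "\<And>x. x \<in> E \<Longrightarrow> (g has_real_derivative g' x) (at x within E)"
    and g': "\<And>x. x \<in> E \<Longrightarrow> 1 \<le> L * \<bar>g' x\<bar>" and inj: "inj_on g E" and "0 < L"
  shows "measure lebesgue E \<le> L * measure lebesgue X"
proof -
  have "g differentiable_on E"
    using der by (meson differentiable_on_def real_differentiable_def)
  then have "g ` E \<in> sets lebesgue"
    using E by (intro differentiable_image_in_sets_lebesgue) (auto simp: fmeasurableD)
  then have im: "g ` E \<in> lmeasurable"
    using X fmeasurableI2 by blast
  then have "(\<lambda>x. 1::real) absolutely_integrable_on g ` E
      \<and> integral (g ` E) (\<lambda>x. 1::real) = measure lebesgue (g ` E)"
    by (auto simp: lmeasure_integral absolutely_integrable_on_const)
  then have *: "(\<lambda>x. \<bar>g' x\<bar> * 1) absolutely_integrable_on E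
      \<and> integral E (\<lambda>x. \<bar>g' x\<bar> * 1) = measure lebesgue (g ` E)"
    using has_absolute_integral_change_of_variables_1'[OF _ der inj, of "\<lambda>_. 1"] E
    by (auto simp: fmeasurableD)
  have "measure lebesgue E = integral E (\<lambda>x. 1)"
    using E by (rule lmeasure_integral)
  also have "\<dots> \<le> integral E (\<lambda>x. L * (\<bar>g' x\<bar> * 1))"
  proof (rule integral_le)
    show "(\<lambda>x. L * (\<bar>g' x\<bar> * 1)) integrable_on E"
      using conjunct1[OF *] by (intro integrable_on_mult_right set_lebesgue_integral_eq_integral(1))
  qed (use E g' in \<open>auto simp: integrable_on_const\<close>)
  also have "\<dots> = L * measure lebesgue (g ` E)"
    using * by simp
  also have "\<dots> \<le> L * measure lebesgue X"
    using im X \<open>0 < L\<close> by (intro mult_left_mono measure_mono_fmeasurable) (auto simp: fmeasurableD)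
  finally show ?thesis .
qed

section \<open>Inverse branches of the iterates\<close>

definition moebius :: "real \<Rightarrow> real \<Rightarrow> real \<Rightarrow> real \<Rightarrow> real \<Rightarrow> real" where
  "moebius a b c d y = (a * y + b) / (c * y + d)"

text \<open>
  The inverse branches of \<open>T\<^sup>n\<close> are Moebius maps of determinant \<open>\<plusminus>1\<close>. Only the denominator \<open>c y + d\<close>
  matters for estimates: the derivative is \<open>\<plusminus>1 / (c y + d)\<^sup>2\<close> and the image of \<open>[0,1]\<close> has length
  \<open>1 / (d (c + d))\<close>. The bound \<open>n + 1 \<le> c + d\<close> is what makes these images shrink.
\<close>

definition farey_inverse_branch :: "nat \<Rightarrow> real \<Rightarrow> real \<Rightarrow> real \<Rightarrow> real \<Rightarrow> bool" where
  "farey_inverse_branch n a b c d \<longleftrightarrow>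
     \<bar>a * d - b * c\<bar> = 1 \<and> 0 \<le> c \<and> 1 \<le> d \<and> real n + 1 \<le> c + d \<and>
     (\<forall>y\<in>{0..1}. moebius a b c d y \<in> {0..1} \<and> (farey_map ^^ n) (moebius a b c d y) = y)"

lemma farey_map_in_unit: "x \<in> {0..1} \<Longrightarrow> farey_map x \<in> {0..1}"
  by (auto simp: farey_map_def field_simps)

lemma funpow_farey_map_in_unit: "x \<in> {0..1} \<Longrightarrow> (farey_map ^^ n) x \<in> {0..1}"
  by (induction n) (use farey_map_in_unit in auto)

lemma farey_inverse_branch_identity: "farey_inverse_branch 0 1 0 0 1"
  by (simp add: farey_inverse_branch_def moebius_def)

text \<open>
  The two inverse branches of \<open>T\<close> are \<open>y / (1 + y)\<close> and \<open>1 / (1 + y)\<close>. Both are right inverses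
  on all of \<open>[0,1]\<close>, endpoints included, because the two formulas for \<open>T\<close> agree at \<open>1/2\<close>.
\<close>

lemma farey_map_left: "y \<in> {0..1} \<Longrightarrow> farey_map (y / (1 + y)) = y"
  by (simp add: farey_map_def field_simps)

lemma farey_map_right: "y \<in> {0..1} \<Longrightarrow> farey_map (1 / (1 + y)) = y"
  by (auto simp: farey_map_def field_simps)

lemma moebius_left:
  assumes "0 \<le> c" "1 \<le> d" "y \<in> {0..1}"
  shows "moebius a b c d (y / (1 + y)) = moebius (a + b) b (c + d) d y"
proof -
  have "1 + y \<noteq> 0" using assms by auto
  then have "a * (y / (1 + y)) + b = ((a + b) * y + b) / (1 + y)" "c * (y / (1 + y)) + d = ((c + d) * y + d) / (1 + y)"
    by (simp_all add: field_simps)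
  with \<open>1 + y \<noteq> 0\<close> show ?thesis by (simp add: moebius_def)
qed

lemma moebius_right:
  assumes "0 \<le> c" "1 \<le> d" "y \<in> {0..1}"
  shows "moebius a b c d (1 / (1 + y)) = moebius b (a + b) d (c + d) y"
proof -
  have "1 + y \<noteq> 0" using assms by auto
  then have "a * (1 / (1 + y)) + b = (b * y + (a + b)) / (1 + y)" "c * (1 / (1 + y)) + d = (d * y + (c + d)) / (1 + y)"
    by (simp_all add: field_simps)
  with \<open>1 + y \<noteq> 0\<close> show ?thesis by (simp add: moebius_def)
qed

text \<open>
  Composing a branch with the two inverse branches of \<open>T\<close> acts on the denominator by
  \<open>(c, d) \<mapsto> (c + d, d)\<close> and \<open>(c, d) \<mapsto> (d, c + d)\<close>. Either way \<open>c + d\<close> grows by \<open>d \<ge> 1\<close>.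
  The second one always leads to \<open>c \<le> d\<close>, which is the case of bounded distortion.
\<close>

lemma farey_inverse_branch_left:
  assumes "farey_inverse_branch n a b c d"
  shows "farey_inverse_branch (Suc n) (a + b) b (c + d) d"
proof -
  have "moebius (a + b) b (c + d) d y \<in> {0..1} \<and>
      (farey_map ^^ Suc n) (moebius (a + b) b (c + d) d y) = y" if y: "y \<in> {0..1}" for y
  proof -
    have "y / (1 + y) \<in> {0..1}" using y by auto
    then show ?thesis
      using assms y farey_map_left[OF y] moebius_left[of c d y a b]
      unfolding farey_inverse_branch_def by (metis comp_apply funpow.simps(2))
  qed
  moreover have "(a + b) * d - b * (c + d) = a * d - b * c"
    by (simp add: algebra_simps)
  ultimately show ?thesis
    using assms unfolding farey_inverse_branch_def by simp
qed

lemma farey_inverse_branch_right: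
  assumes "farey_inverse_branch n a b c d"
  shows "farey_inverse_branch (Suc n) b (a + b) d (c + d)"
proof -
  have "moebius b (a + b) d (c + d) y \<in> {0..1} \<and>
      (farey_map ^^ Suc n) (moebius b (a + b) d (c + d) y) = y" if y: "y \<in> {0..1}" for y
  proof -
    have "1 / (1 + y) \<in> {0..1}" using y by auto
    then show ?thesis
      using assms y farey_map_right[OF y] moebius_right[of c d y a b]
      unfolding farey_inverse_branch_def by (metis comp_apply funpow.simps(2))
  qed
  moreover have "b * (c + d) - (a + b) * d = - (a * d - b * c)"
    by (simp add: algebra_simps)
  then have "\<bar>b * (c + d) - (a + b) * d\<bar> = \<bar>a * d - b * c\<bar>"
    by (metis abs_minus_cancel)
  ultimately show ?thesis
    using assms unfolding farey_inverse_branch_def by simp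
qed

lemma farey_map_inverse_left: "x \<in> {0..1} \<Longrightarrow> x \<le> 1/2 \<Longrightarrow> farey_map x / (1 + farey_map x) = x"
  by (simp add: farey_map_def field_simps)

lemma farey_map_inverse_right: "x \<in> {0..1} \<Longrightarrow> 1/2 < x \<Longrightarrow> 1 / (1 + farey_map x) = x"
  by (simp add: farey_map_def field_simps)

lemma ex_farey_inverse_branch:
  assumes "x \<in> {0..1}"
  shows "\<exists>a b c d. farey_inverse_branch n a b c d \<and> moebius a b c d ((farey_map ^^ n) x) = x"
proof (induction n)
  case 0
  show ?case
    using farey_inverse_branch_identity by (force simp: moebius_def)
next
  case (Suc n)
  then obtain a b c d where *: "farey_inverse_branch n a b c d"
    "moebius a b c d ((farey_map ^^ n) x) = x" by blast
  define y where "y = (farey_map ^^ n) x"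
  have y: "y \<in> {0..1}" "farey_map y \<in> {0..1}"
    using assms funpow_farey_map_in_unit farey_map_in_unit unfolding y_def by blast+
  have cd: "0 \<le> c" "1 \<le> d" using * by (auto simp: farey_inverse_branch_def)
  show ?case
  proof (cases "y \<le> 1/2")
    case True
    then have "moebius (a + b) b (c + d) d (farey_map y) = x"
      using * moebius_left[OF cd y(2), of a b] farey_map_inverse_left[OF y(1)] by (simp add: y_def)
    then show ?thesis
      using farey_inverse_branch_left[OF *(1)] by (auto simp: y_def)
  next
    case False
    then have "moebius b (a + b) d (c + d) (farey_map y) = x"
      using * moebius_right[OF cd y(2), of a b] farey_map_inverse_right[OF y(1)]
      by (simp add: y_def)
    then show ?thesis
      using farey_inverse_branch_right[OF *(1)] by (auto simp: y_def)
  qed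
qed

lemma moebius_diff:
  assumes "0 \<le> c" "1 \<le> d" "y \<in> {0..1}" "z \<in> {0..1}"
  shows "moebius a b c d y - moebius a b c d z
    = (a * d - b * c) * (y - z) / ((c * y + d) * (c * z + d))"
proof -
  have "0 < c * y + d" "0 < c * z + d"
    using assms by (auto intro: add_nonneg_pos)
  then show ?thesis
    by (simp add: moebius_def field_simps)
qed

lemma moebius_has_derivative:
  assumes "0 \<le> c" "1 \<le> d" "y \<in> {0..1}"
  shows "(moebius a b c d has_real_derivative (a * d - b * c) / (c * y + d)\<^sup>2) (at y within E)"
proof -
  have "0 < c * y + d"
    using assms by (auto intro: add_nonneg_pos)
  then show ?thesis
    unfolding moebius_def[abs_def]
    by (auto intro!: derivative_eq_intros simp: field_simps power2_eq_square)
qed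

lemma farey_inverse_branch_image:
  assumes "farey_inverse_branch n a b c d"
  obtains l h where "l < h" "h - l \<le> 1 / (d * (c + d))" "moebius a b c d ` {0..1} = {l..h}"
proof -
  let ?u = "moebius a b c d"
  have cd: "0 \<le> c" "1 \<le> d" and det: "\<bar>a * d - b * c\<bar> = 1"
    using assms by (auto simp: farey_inverse_branch_def)
  have "continuous_on {0..1} ?u"
    using moebius_has_derivative[OF cd] by (intro DERIV_continuous_on) auto
  then obtain l h where lh: "?u ` {0..1} = {l..h}"
    using connected_compact_interval_1[of "?u ` {0..1}"]
    by (metis compact_Icc compact_continuous_image connected_Icc connected_continuous_image)
  have inj: "inj_on ?u {0..1}"
    using assms unfolding farey_inverse_branch_def by (metis inj_on_inverseI)
  have "?u 0 \<noteq> ?u 1"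
    using inj by (auto dest: inj_onD)
  moreover have "?u 0 \<in> {l..h}" "?u 1 \<in> {l..h}"
    unfolding lh[symmetric] by auto
  ultimately have "l < h" by auto
  have *: "\<bar>?u y - ?u z\<bar> \<le> 1 / (d * (c + d))" if "0 \<le> z" "z \<le> y" "y \<le> 1" for y z
  proof -
    have pos: "0 < c * y + d" "0 < c * z + d" "0 < c + d"
      using that cd by (auto intro: add_nonneg_pos)
    have "\<bar>?u y - ?u z\<bar> = (y - z) / ((c * y + d) * (c * z + d))"
      using moebius_diff[OF cd, of y z a b] that det pos by (simp add: abs_mult)
    also have "\<dots> \<le> y / ((c * y + d) * d)"
      using that cd pos by (intro frac_le mult_left_mono) auto
    also have "\<dots> \<le> 1 / (d * (c + d))"
    proof -
      have "d * y \<le> d" using that cd by simp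
      then have "y * (c + d) \<le> c * y + d" by (simp add: algebra_simps)
      then have "y / (c * y + d) \<le> 1 / (c + d)" using pos by (simp add: field_simps)
      then have "y / (c * y + d) / d \<le> 1 / (c + d) / d" using cd by (intro divide_right_mono) auto
      then show ?thesis by (simp add: mult.commute)
    qed
    finally show ?thesis .
  qed
  have "l \<in> ?u ` {0..1}" "h \<in> ?u ` {0..1}"
    using \<open>l < h\<close> by (auto simp: lh)
  then obtain y z where yz: "y \<in> {0..1}" "z \<in> {0..1}" "h = ?u y" "l = ?u z" by blast
  have "h - l \<le> 1 / (d * (c + d))"
    using *[of y z] *[of z y] yz by (cases "y \<le> z") auto
  then show thesis
    using that \<open>l < h\<close> lh by blast
qed

text \<open>
  As the image of \<open>[0,1]\<close> has length about \<open>1 / (d (c + d))\<close>, this says that relative measure inside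
  that image controls measure in \<open>[0,1]\<close> up to the factor \<open>(c + d) / d\<close>, which is at most \<open>2\<close> as soon
  as \<open>c \<le> d\<close>.
\<close>

lemma farey_inverse_branch_measure_le:
  assumes br: "farey_inverse_branch n a b c d"
    and E: "E \<in> lmeasurable" "E \<subseteq> {0..1}" and X: "X \<in> lmeasurable" "moebius a b c d ` E \<subseteq> X"
  shows "measure lebesgue E \<le> (c + d)\<^sup>2 * measure lebesgue X"
proof (rule measure_le_expanding_image[OF E(1) X])
  have cd: "0 \<le> c" "1 \<le> d" and det: "\<bar>a * d - b * c\<bar> = 1"
    using br by (auto simp: farey_inverse_branch_def)
  fix x assume "x \<in> E"
  then have x: "x \<in> {0..1}" using E by auto
  show "(moebius a b c d has_real_derivative (a * d - b * c) / (c * x + d)\<^sup>2) (at x within E)"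
    using moebius_has_derivative[OF cd x] .
  have pos: "0 < c * x + d" using x cd by (auto intro: add_nonneg_pos)
  have "c * x \<le> c" using x cd by (simp add: mult_left_le)
  then have "(c * x + d)\<^sup>2 \<le> (c + d)\<^sup>2"
    using pos by (intro power_mono) auto
  then show "1 \<le> (c + d)\<^sup>2 * \<bar>(a * d - b * c) / (c * x + d)\<^sup>2\<bar>"
    using det pos by (simp add: field_simps)
next
  show "inj_on (moebius a b c d) E"
    using br E unfolding farey_inverse_branch_def by (metis inj_on_inverseI subsetD)
  show "0 < (c + d)\<^sup>2"
    using br by (auto simp: farey_inverse_branch_def)
qed

text \<open>
  The left inverse branch alone already puts a copy of \<open>E\<close>, shrunk at most by the factor \<open>4\<close>, into
  the preimage. Applied to complements, this shows that a nearly full set stays nearly full one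
  step later.
\<close>

lemma measure_le_farey_preimage:
  assumes "E \<in> lmeasurable" "E \<subseteq> {0..1}" "X \<in> lmeasurable"
    and "\<And>x. x \<in> {0..1} \<Longrightarrow> farey_map x \<in> E \<Longrightarrow> x \<in> X"
  shows "measure lebesgue E \<le> 4 * measure lebesgue X"
proof -
  have br: "farey_inverse_branch (Suc 0) 1 0 1 1"
    using farey_inverse_branch_left[OF farey_inverse_branch_identity] by simp
  have "moebius 1 0 1 1 ` E \<subseteq> X"
    using br assms(2,4) unfolding farey_inverse_branch_def by force
  from farey_inverse_branch_measure_le[OF br assms(1-3) this] show ?thesis
    by simp
qed

lemma negligible_farey_preimage:
  assumes "negligible E"
  shows "negligible {x\<in>{0..1}. farey_map x \<in> E}"
proof -
  let ?E = "E \<inter> {0..1}"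
  have neg: "negligible (moebius a b 1 1 ` ?E)" for a b
  proof (rule negligible_differentiable_image_negligible)
    show "negligible ?E" using assms negligible_subset by blast
    show "moebius a b 1 1 differentiable_on ?E"
      using moebius_has_derivative[of 1 1 _ a b ?E]
      unfolding differentiable_on_def real_differentiable_def by fastforce
  qed simp
  have "x \<in> moebius 1 0 1 1 ` ?E \<union> moebius 0 1 1 1 ` ?E"
    if "x \<in> {0..1}" "farey_map x \<in> E" for x
  proof (cases "x \<le> 1/2")
    case True
    then have "x = moebius 1 0 1 1 (farey_map x)"
      using farey_map_inverse_left[OF that(1)] by (simp add: moebius_def add.commute)
    then show ?thesis using that farey_map_in_unit by blast
  next
    case False
    then have "x = moebius 0 1 1 1 (farey_map x)"
      using farey_map_inverse_right[OF that(1)] by (simp add: moebius_def add.commute)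
    then show ?thesis using that farey_map_in_unit by blast
  qed
  then show ?thesis
    by (intro negligible_subset[OF negligible_Un[OF neg[of 1 0] neg[of 0 1]]]) auto
qed

section \<open>Returns to the expanding half\<close>

lemma irrational_farey_map:
  assumes "x \<in> {0..1}" "x \<notin> \<rat>"
  shows "farey_map x \<notin> \<rat>"
proof
  assume "farey_map x \<in> \<rat>"
  then have "farey_map x / (1 + farey_map x) \<in> \<rat>" "1 / (1 + farey_map x) \<in> \<rat>"
    by auto
  then show False
    using farey_map_inverse_left farey_map_inverse_right assms by (metis not_le)
qed

text \<open>
  On \<open>(0, 1/2]\<close> the map lowers \<open>1 / x\<close> by exactly one, while \<open>1 / x\<close> stays positive. So an orbit
  that never meets \<open>0\<close>, such as that of an irrational number, cannot remain in \<open>[0, 1/2]\<close>.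
\<close>

lemma farey_map_returns:
  assumes x: "x \<in> {0..1}" "x \<notin> \<rat>"
  obtains (returns) n where "N \<le> n" "1/2 < (farey_map ^^ n) x"
proof (rule ccontr)
  assume contr: "\<not> thesis"
  have low: "(farey_map ^^ n) x \<le> 1/2" if "N \<le> n" for n
  proof (rule ccontr)
    assume "\<not> ?thesis"
    then have "1/2 < (farey_map ^^ n) x" by simp
    then show False using \<open>N \<le> n\<close> contr returns by blast
  qed
  have pos: "0 < (farey_map ^^ n) x" for n
  proof -
    have "(farey_map ^^ n) x \<notin> \<rat>"
      by (induction n) (use x funpow_farey_map_in_unit[OF x(1)] irrational_farey_map in auto)
    then have "(farey_map ^^ n) x \<noteq> 0" by (metis Rats_0)
    then show ?thesis using funpow_farey_map_in_unit[OF x(1), of n] by auto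
  qed
  define t where "t = 1 / (farey_map ^^ N) x"
  have "1 / (farey_map ^^ (N + k)) x = t - real k" for k
  proof (induction k)
    case (Suc k)
    let ?z = "(farey_map ^^ (N + k)) x"
    have "1 / farey_map ?z = 1 / ?z - 1"
      using pos[of "N + k"] low[of "N + k"] by (simp add: farey_map_def field_simps)
    then show ?case using Suc by simp
  qed (simp add: t_def)
  moreover obtain k where "t < real k"
    using reals_Archimedean2 by blast
  ultimately show False
    using pos[of "N + k"] by (metis diff_less_0_iff_less not_less_iff_gr_or_eq zero_less_divide_1_iff)
qed

section \<open>Tail sets\<close>

text \<open>
  A tail set \<open>A\<close> is presented by the sets \<open>B n\<close> with \<open>A = T\<^sup>-\<^sup>n(B n)\<close>. As \<open>T\<^sup>n\<close> maps onto
  \<open>[0,1]\<close>, these are unique, and they are linked by \<open>B n = T\<^sup>-\<^sup>1(B (n + 1))\<close>. This one-step form is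
  stable under shifts and differences.
\<close>

definition farey_tower :: "(nat \<Rightarrow> real set) \<Rightarrow> bool" where
  "farey_tower B \<longleftrightarrow> (\<forall>n. B n \<in> sets borel \<and> B n \<subseteq> {0..1} \<and>
     (\<forall>x\<in>{0..1}. x \<in> B n \<longleftrightarrow> farey_map x \<in> B (Suc n)))"

lemma farey_tower_lmeasurable: "farey_tower B \<Longrightarrow> B n \<in> lmeasurable"
  unfolding farey_tower_def
  by (intro bounded_set_imp_lmeasurable) (auto intro: bounded_subset[OF bounded_closed_interval])

lemma farey_tower_iterate:
  assumes "farey_tower B" "x \<in> {0..1}"
  shows "x \<in> B 0 \<longleftrightarrow> (farey_map ^^ n) x \<in> B n"
proof (induction n)
  case (Suc n)
  then show ?case
    using assms funpow_farey_map_in_unit[OF assms(2), of n] by (simp add: farey_tower_def)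
qed simp

lemma farey_tower_shift: "farey_tower B \<Longrightarrow> farey_tower (\<lambda>n. B (n + k))"
  by (simp add: farey_tower_def)

lemma farey_tower_Diff: "farey_tower B \<Longrightarrow> farey_tower C \<Longrightarrow> farey_tower (\<lambda>n. B n - C n)"
  unfolding farey_tower_def by blast

text \<open>
  The analytic core. The images of branches with \<open>c \<le> d\<close> form a Vitali class at every irrational
  point: each return of the orbit to \<open>(1/2, 1]\<close> yields one, and their lengths tend to zero. So one of
  them lies almost entirely in \<open>B 0\<close>, and by bounded distortion \<open>B n\<close> is then almost all of \<open>[0,1]\<close>.
  That \<open>B (n + 1)\<close> is also nearly full for the same \<open>n\<close> is what makes the argument work for tail
  sets and not just for invariant sets.
\<close>

lemma farey_tower_fills:
  assumes B: "farey_tower B" and pos: "0 < measure lebesgue (B 0)" and "0 < e"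
  obtains n where "measure lebesgue ({0..1} - B n) < e" "measure lebesgue ({0..1} - B (Suc n)) < e"
proof -
  \<comment> \<open>Cylinders of bounded distortion, encoded by their endpoints.\<close>
  define K where "K = {(l, h). l < h \<and> (\<exists>n a b c d. farey_inverse_branch n a b c d \<and> c \<le> d \<and>
     h - l \<le> 1 / (d * (c + d)) \<and> moebius a b c d ` {0..1} = {l..h})}"
  let ?m = "\<lambda>(l, h). (l + h) / 2 :: real" and ?r = "\<lambda>(l, h). (h - l) / 2 :: real"
  have ball: "cball (?m (l, h)) (?r (l, h)) = {l..h}" for l h
    by (auto simp: cball_eq_atLeastAtMost field_simps)
  \<comment> \<open>Removing the rationals costs nothing and makes every orbit return to \<open>(1/2, 1]\<close>.\<close>
  define S where "S = B 0 - \<rat>"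
  have meas: "{0..1} - B n \<in> lmeasurable" for n
    using farey_tower_lmeasurable[OF B] by (intro fmeasurable.Diff) (auto simp: fmeasurableD)
  have neg: "negligible (\<rat> :: real set)"
    by (simp add: countable_rat negligible_iff_null_sets countable_imp_null_set_lborel null_sets_completionI)
  have S: "S \<in> lmeasurable" "0 < measure lebesgue S"
    using farey_tower_lmeasurable[OF B] neg pos unfolding S_def
    by (auto simp: measure_Diff_null_set negligible_iff_null_sets fmeasurableD intro: fmeasurable_Diff)
  have fine: "\<exists>i\<in>K. x \<in> cball (?m i) (?r i) \<and> ?r i < t" if "x \<in> S" "0 < t" for x t
  proof -
    have x: "x \<in> {0..1}" "x \<notin> \<rat>"
      using that B unfolding S_def farey_tower_def by blast+
    obtain N where N: "1 / real (Suc N) < t"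
      using \<open>0 < t\<close> nat_approx_posE by blast
    obtain n where n: "N \<le> n" "1/2 < (farey_map ^^ n) x"
      using farey_map_returns[OF x] .
    obtain a b c d where *: "farey_inverse_branch n a b c d"
      "moebius a b c d ((farey_map ^^ n) x) = x"
      using ex_farey_inverse_branch[OF x(1)] by blast
    then have cd: "0 \<le> c" "1 \<le> d" "real n + 1 \<le> c + d"
      by (auto simp: farey_inverse_branch_def)
    let ?y = "(farey_map ^^ n) x"
    have y: "?y \<in> {0..1}" "farey_map ?y \<in> {0..1}"
      using x funpow_farey_map_in_unit farey_map_in_unit by blast+
    \<comment> \<open>The step after a return uses the right inverse branch, which forces bounded distortion.\<close>
    have "moebius b (a + b) d (c + d) (farey_map ?y) = x"
      using * moebius_right[OF cd(1,2) y(2), of a b] farey_map_inverse_right[OF y(1) n(2)] by simp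
    then have xin: "x \<in> moebius b (a + b) d (c + d) ` {0..1}"
      using y by force
    note br = farey_inverse_branch_right[OF *(1)]
    obtain l h where lh: "l < h" "h - l \<le> 1 / ((c + d) * (d + (c + d)))"
      "moebius b (a + b) d (c + d) ` {0..1} = {l..h}"
      using farey_inverse_branch_image[OF br] .
    have "real (Suc N) \<le> (c + d) * 1"
      using n cd by simp
    also have "\<dots> \<le> (c + d) * (d + (c + d))"
      using cd by (intro mult_left_mono) auto
    finally have "1 / ((c + d) * (d + (c + d))) \<le> 1 / real (Suc N)"
      by (intro divide_left_mono) auto
    then have "h - l < t" using lh N by simp
    moreover have "d \<le> c + d" using cd by simp
    then have "(l, h) \<in> K"
      using lh br unfolding K_def by blast
    ultimately show ?thesis
      using xin lh ball by (intro bexI[of _ "(l, h)"]) auto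
  qed
  have rpos: "0 < ?r i" if "i \<in> K" for i
    using that by (auto simp: K_def)
  \<comment> \<open>Distortion costs a factor \<open>2\<close> and the extra step a factor \<open>4\<close>, which turns \<open>e / 16\<close> into \<open>e / 2\<close>.\<close>
  obtain i where i: "i \<in> K"
    "measure lebesgue (cball (?m i) (?r i) - S) < e / 16 * measure lebesgue (cball (?m i) (?r i))"
    using ex_relatively_dense_cball[OF S, of "e / 16" K ?r ?m] rpos fine \<open>0 < e\<close> by auto
  obtain l h where "i = (l, h)" by fastforce
  with i obtain n a b c d where lh: "l < h" and br: "farey_inverse_branch n a b c d" and "c \<le> d"
    and len: "h - l \<le> 1 / (d * (c + d))" and im: "moebius a b c d ` {0..1} = {l..h}"
    by (auto simp: K_def)
  have cd: "0 \<le> c" "1 \<le> d" using br by (auto simp: farey_inverse_branch_def)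
  have small: "measure lebesgue ({l..h} - S) < e / 16 * (h - l)"
    using i(2) lh by (simp add: \<open>i = (l, h)\<close> ball[unfolded split])
  have sub: "moebius a b c d ` ({0..1} - B n) \<subseteq> {l..h} - S"
  proof (rule image_subsetI)
    fix y assume y: "y \<in> {0..1} - B n"
    then have "moebius a b c d y \<in> {l..h}" using im by blast
    moreover have "moebius a b c d y \<notin> B 0"
      using farey_tower_iterate[OF B, of "moebius a b c d y" n] br y
      by (auto simp: farey_inverse_branch_def)
    ultimately show "moebius a b c d y \<in> {l..h} - S"
      by (simp add: S_def)
  qed
  have "measure lebesgue ({0..1} - B n) \<le> (c + d)\<^sup>2 * measure lebesgue ({l..h} - S)"
    using S by (intro farey_inverse_branch_measure_le[OF br meas _ _ sub]) (auto intro: fmeasurable.Diff)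
  also have "\<dots> \<le> (c + d)\<^sup>2 * (e / 16 * (1 / (d * (c + d))))"
  proof (intro mult_left_mono order_trans[OF less_imp_le[OF small]] len)
  qed (use \<open>0 < e\<close> in auto)
  also have "\<dots> = e / 16 * ((c + d) / d)"
    using cd by (simp add: power2_eq_square)
  also have "\<dots> \<le> e / 16 * 2"
    using cd \<open>c \<le> d\<close> \<open>0 < e\<close> by (intro mult_left_mono) (auto simp: field_simps)
  finally have n: "measure lebesgue ({0..1} - B n) \<le> e / 8" by simp
  have "measure lebesgue ({0..1} - B (Suc n)) \<le> 4 * measure lebesgue ({0..1} - B n)"
    using B by (intro measure_le_farey_preimage meas) (auto simp: farey_tower_def)
  then show thesis
    using that[of n] n \<open>0 < e\<close> by simp
qed

section \<open>Reduction from the invariant measure to Lebesgue measure\<close>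

lemma sets_farey_measure_iff: "A \<in> sets farey_measure \<longleftrightarrow> A \<in> sets borel \<and> A \<subseteq> {0..1}"
  by (auto simp: sets_farey_measure sets_restrict_space_iff)

lemma emeasure_farey_measure_eq_0_iff:
  assumes A: "A \<in> sets farey_measure"
  shows "emeasure farey_measure A = 0 \<longleftrightarrow> negligible A"
proof -
  have A': "A \<in> sets borel" "A \<subseteq> {0..1}"
    using A by (auto simp: sets_farey_measure_iff)
  have f: "(\<lambda>x. ennreal (1 / x)) \<in> borel_measurable unit_lebesgue"
    unfolding unit_lebesgue_def by (intro measurable_restrict_space1) simp
  have "emeasure farey_measure A = 0 \<longleftrightarrow> A \<in> null_sets farey_measure"
    using A by (simp add: null_sets_def)
  also have "\<dots> \<longleftrightarrow> (AE x in unit_lebesgue. x \<in> A \<longrightarrow> ennreal (1 / x) = 0)"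
    using A null_sets_density_iff[OF f, of A] unfolding farey_measure_def by simp
  also have "\<dots> \<longleftrightarrow> (AE x in lborel. x \<in> {0..1} \<longrightarrow> x \<in> A \<longrightarrow> ennreal (1 / x) = 0)"
    unfolding unit_lebesgue_def by (subst AE_restrict_space_iff) auto
  also have "\<dots> \<longleftrightarrow> (AE x in lborel. x \<notin> A)"
  proof
    assume "AE x in lborel. x \<in> {0..1} \<longrightarrow> x \<in> A \<longrightarrow> ennreal (1 / x) = 0"
    with AE_lborel_singleton[of "0::real"] show "AE x in lborel. x \<notin> A"
    proof eventually_elim
      case (elim x)
      show ?case
      proof
        assume "x \<in> A"
        then have "0 < x" using elim A' by force
        then show False using elim A' \<open>x \<in> A\<close> by (auto simp: ennreal_eq_0_iff)
      qed
    qed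
  qed (auto elim: eventually_mono)
  also have "\<dots> \<longleftrightarrow> A \<in> null_sets lborel"
    using A' by (simp add: AE_iff_null_sets)
  also have "\<dots> \<longleftrightarrow> negligible A"
    using A' by (simp add: negligible_iff_null_sets null_sets_completion_iff)
  finally show ?thesis .
qed

lemma sigma_finite_farey_measure: "sigma_finite_measure farey_measure"
proof -
  have f: "(\<lambda>x. ennreal (1 / x)) \<in> borel_measurable unit_lebesgue"
    unfolding unit_lebesgue_def by (intro measurable_restrict_space1) simp
  have "emeasure unit_lebesgue (space unit_lebesgue) = 1"
    by (simp add: unit_lebesgue_def emeasure_restrict_space space_restrict_space)
  then have "finite_measure unit_lebesgue"
    by (intro finite_measureI) simp
  then have "sigma_finite_measure unit_lebesgue"
    by (rule finite_measure.axioms(1))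
  from sigma_finite_measure.sigma_finite_iff_density_finite[OF this f] show ?thesis
    by (simp add: farey_measure_def)
qed

lemma farey_map_measurable: "farey_map \<in> measurable farey_measure farey_measure"
proof -
  have "farey_map \<in> borel_measurable borel"
    unfolding farey_map_def[abs_def] by measurable
  then have "farey_map \<in> measurable (restrict_space borel {0..1}) (restrict_space borel {0..1})"
    using farey_map_in_unit
    by (intro measurable_restrict_space2 measurable_restrict_space1) (auto simp: space_restrict_space)
  then show ?thesis
    using measurable_cong_sets[OF sets_farey_measure sets_farey_measure] by blast
qed

text \<open>
  The measures \<open>\<mu>\<close> and \<open>\<lambda>\<close> have the same null sets, so it suffices to compare Lebesgue measures of
  a set and its preimage.
\<close>

lemma nonsingular_farey_map: "nonsingular_transformation farey_measure farey_map"
  unfolding nonsingular_transformation_def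
proof (intro conjI ballI farey_map_measurable)
  fix A assume A: "A \<in> sets farey_measure"
  let ?P = "farey_map -` A \<inter> space farey_measure"
  have P: "?P \<in> sets farey_measure"
    using farey_map_measurable A by (rule measurable_sets)
  have Peq: "?P = {x\<in>{0..1}. farey_map x \<in> A}"
    by (auto simp: space_farey_measure)
  have lm: "X \<in> lmeasurable" if "X \<in> sets farey_measure" for X
    using that by (intro bounded_set_imp_lmeasurable)
      (auto simp: sets_farey_measure_iff intro: bounded_subset[of "{0..1}"])
  have "negligible ?P \<longleftrightarrow> negligible A"
  proof
    assume "negligible ?P"
    then have "measure lebesgue ?P = 0"
      by (simp add: negligible_imp_measure0)
    moreover have "measure lebesgue A \<le> 4 * measure lebesgue ?P"
      using A P by (intro measure_le_farey_preimage lm) (auto simp: sets_farey_measure_iff Peq)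
    ultimately show "negligible A"
      using lm[OF A] by (simp add: negligible_iff_measure measure_le_0_iff)
  next
    assume "negligible A"
    then show "negligible ?P"
      unfolding Peq by (rule negligible_farey_preimage)
  qed
  then show "emeasure farey_measure ?P = 0 \<longleftrightarrow> emeasure farey_measure A = 0"
    using A P by (simp add: emeasure_farey_measure_eq_0_iff)
qed

section \<open>Triviality of the tail\<close>

lemma funpow_farey_map_surj:
  assumes "y \<in> {0..1}"
  obtains x where "x \<in> {0..1}" "(farey_map ^^ n) x = y"
proof -
  obtain a b c d where "farey_inverse_branch n a b c d"
    using ex_farey_inverse_branch[of 0 n] by auto
  then show thesis
    using assms that unfolding farey_inverse_branch_def by blast
qed

lemma tail_set_farey_tower:
  assumes "A \<in> tail_sets farey_measure farey_map"
  obtains B where "farey_tower B" "B 0 = A"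
proof -
  have "\<exists>B. B \<in> sets farey_measure \<and> A = (farey_map ^^ n) -` B \<inter> {0..1}" for n
    using assms unfolding tail_sets_def space_farey_measure by blast
  then obtain B where B: "\<And>n. B n \<in> sets farey_measure"
    "\<And>n. A = (farey_map ^^ n) -` B n \<inter> {0..1}"
    by metis
  have "y \<in> B n \<longleftrightarrow> farey_map y \<in> B (Suc n)" if y: "y \<in> {0..1}" for n y
  proof -
    obtain x where x: "x \<in> {0..1}" "(farey_map ^^ n) x = y"
      using funpow_farey_map_surj[OF y] .
    have "y \<in> B n \<longleftrightarrow> x \<in> A" using B(2)[of n] x by auto
    also have "\<dots> \<longleftrightarrow> farey_map y \<in> B (Suc n)" using B(2)[of "Suc n"] x by auto
    finally show ?thesis .
  qed
  then have "farey_tower B"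
    using B(1) by (auto simp: farey_tower_def sets_farey_measure_iff)
  moreover have "B 0 = A"
    using B(1)[of 0] B(2)[of 0] by (auto simp: sets_farey_measure_iff)
  ultimately show thesis using that by blast
qed

text \<open>
  Two consecutive levels that each fill more than half of \<open>[0,1]\<close> must meet.
\<close>

lemma farey_tower_disjoint_null:
  assumes B: "farey_tower B" and dis: "\<And>n. B n \<inter> B (Suc n) = {}"
  shows "measure lebesgue (B 0) = 0"
proof (rule ccontr)
  assume "measure lebesgue (B 0) \<noteq> 0"
  then have "0 < measure lebesgue (B 0)"
    by (simp add: zero_less_measure_iff)
  then obtain n where n: "measure lebesgue ({0..1} - B n) < 1/2"
    "measure lebesgue ({0..1} - B (Suc n)) < 1/2"
    using farey_tower_fills[OF B, of "1/2"] by auto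
  have meas: "{0..1} - B n \<in> lmeasurable" for n
    using farey_tower_lmeasurable[OF B] by (intro fmeasurable.Diff) (auto simp: fmeasurableD)
  have "1 = measure lebesgue {0..1::real}" by simp
  also have "\<dots> \<le> measure lebesgue (({0..1} - B n) \<union> ({0..1} - B (Suc n)))"
    using dis[of n] meas by (intro measure_mono_fmeasurable) (auto intro: fmeasurable.Un)
  also have "\<dots> \<le> measure lebesgue ({0..1} - B n) + measure lebesgue ({0..1} - B (Suc n))"
    using meas by (intro measure_Un_le) (auto simp: fmeasurableD)
  finally show False using n by simp
qed

text \<open>
  The differences \<open>B n - B (n + 1)\<close> again form a tower, and its consecutive levels are disjoint; the
  same holds with the two terms exchanged. Hence the one-step shift acts trivially on tail sets, up
  to null sets.
\<close>

lemma farey_tower_consecutive_measure: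
  assumes B: "farey_tower B"
  shows "measure lebesgue (B (Suc 0)) = measure lebesgue (B 0)"
proof -
  have B': "farey_tower (\<lambda>n. B (Suc n))"
    using farey_tower_shift[OF B, of 1] by simp
  have "measure lebesgue (B 0 - B (Suc 0)) = 0" "measure lebesgue (B (Suc 0) - B 0) = 0"
    using farey_tower_disjoint_null[OF farey_tower_Diff[OF B B']]
      farey_tower_disjoint_null[OF farey_tower_Diff[OF B' B]] by auto
  then have "negligible (B 0 - B (Suc 0))" "negligible (B (Suc 0) - B 0)"
    using farey_tower_lmeasurable[OF farey_tower_Diff[OF B B'], of 0]
      farey_tower_lmeasurable[OF farey_tower_Diff[OF B' B], of 0]
    by (simp_all add: negligible_iff_measure)
  then have "negligible (sym_diff (B 0) (B (Suc 0)))"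
    by (rule negligible_Un)
  then show ?thesis
    using measure_negligible_symdiff farey_tower_lmeasurable[OF B] by blast
qed

lemma farey_tower_measure_const:
  assumes B: "farey_tower B"
  shows "measure lebesgue (B n) = measure lebesgue (B 0)"
proof (induction n)
  case (Suc n)
  then show ?case
    using farey_tower_consecutive_measure[OF farey_tower_shift[OF B, of n]] by simp
qed simp

text \<open>
  All levels have the same measure, yet some level comes arbitrarily close to full measure unless
  the bottom level is null.
\<close>

lemma farey_tower_trivial:
  assumes B: "farey_tower B"
  shows "negligible (B 0) \<or> negligible ({0..1} - B 0)"
proof (cases "measure lebesgue (B 0) = 0")
  case True
  then show ?thesis
    using farey_tower_lmeasurable[OF B] by (simp add: negligible_iff_measure)
next
  case False
  then have pos: "0 < measure lebesgue (B 0)"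
    by (simp add: zero_less_measure_iff)
  have eq: "measure lebesgue ({0..1} - B n) = 1 - measure lebesgue (B n)" for n
  proof -
    have "B n \<subseteq> {0..1}"
      using B unfolding farey_tower_def by blast
    then show ?thesis
      using farey_tower_lmeasurable[OF B, of n] by (subst measure_Diff) (auto simp: fmeasurableD)
  qed
  have "measure lebesgue ({0..1} - B 0) \<le> 0"
  proof (rule field_le_epsilon)
    fix e :: real assume "0 < e"
    then obtain n where "measure lebesgue ({0..1} - B n) < e"
      using farey_tower_fills[OF B pos] by blast
    then show "measure lebesgue ({0..1} - B 0) \<le> 0 + e"
      using farey_tower_measure_const[OF B, of n] by (simp add: eq)
  qed
  moreover have "{0..1} - B 0 \<in> lmeasurable"
    using farey_tower_lmeasurable[OF B] by (intro fmeasurable.Diff) (auto simp: fmeasurableD)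
  ultimately show ?thesis
    by (simp add: negligible_iff_measure measure_le_0_iff)
qed

theorem proposition3p3:
  shows "exact_transformation farey_measure farey_map"
  unfolding exact_transformation_def
proof (intro conjI ballI sigma_finite_farey_measure nonsingular_farey_map)
  fix A assume "A \<in> tail_sets farey_measure farey_map"
  then obtain B where B: "farey_tower B" "B 0 = A"
    by (rule tail_set_farey_tower)
  then have "A \<in> sets farey_measure"
    by (auto simp: farey_tower_def sets_farey_measure_iff)
  then have "{0..1} - A \<in> sets farey_measure" 
    by (metis sets.compl_sets space_farey_measure)
  then show "emeasure farey_measure A = 0 \<or> emeasure farey_measure (space farey_measure - A) = 0"
    using farey_tower_trivial[OF B(1)] \<open>A \<in> sets farey_measure\<close> B(2)
    by (simp add: emeasure_farey_measure_eq_0_iff space_farey_measure)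
qed

end
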